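(* For any sequence of positive numbers $a_i\downarrow0$ it holds $$f^d_{a_i}\longrightarrow\kappa\,\mathbf 1_{(0,\infty)}\qquad\text{pointwise on }[0,\infty).$$
   Context: Let $d\ge1$ be an integer, $p>d$, and $\omega_d$ the volume of the unit ball of $\mathbf R^d$. For $\hat r\ge0$, $\xi\ge0$ set $$q^d_\infty(\xi,\hat r)=\inf\Big\{\int_{\hat r}^{\infty}t^{d-1}\big[|v'|^p+(1-v)^2\big]dt:\ v\in W^{1,p}_{loc}((\hat r,\infty))\cap C([\hat r,\infty)),\ v(\hat r)=\xi,\ \lim_{t\to\infty}v(t)=1\Big\}.$$ For $a>0$, $f_a^d(0)=0$ and for $m>0$ $$f_a^d(m)=\min_{\hat r>0}\Big\{\frac{a\,m^2}{\omega_d\hat r^d}+\omega_d\hat r^d+d\,\omega_d\,q^d_\infty(0,\hat r)\Big\}.$$ The constant is $\kappa=d\,\omega_d\,q^d_\infty(0,0)$. *)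

theory Defs
  imports "HOL-Analysis.Analysis"
begin

text \<open>Test functions: the space of infinitely differentiable functions whose support is a
  compact subset of the open set \<open>U\<close>.\<close>

definition test_function :: "real set \<Rightarrow> (real \<Rightarrow> real) \<Rightarrow> bool" where
  "test_function U \<phi> \<longleftrightarrow>
     (\<forall>n x. (deriv ^^ n) \<phi> differentiable (at x)) \<and>
     compact (closure {x. \<phi> x \<noteq> 0}) \<and> closure {x. \<phi> x \<noteq> 0} \<subseteq> U"

text \<open>Elements of \<open>L\<^sup>p\<^sub>l\<^sub>o\<^sub>c(U)\<close> are given by Borel representatives; every Lebesgue measurable
  function agrees almost everywhere with such a representative.\<close>

definition Lp_loc :: "real \<Rightarrow> real set \<Rightarrow> (real \<Rightarrow> real) \<Rightarrow> bool" where
  "Lp_loc p U f \<longleftrightarrow>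
     set_borel_measurable lborel U f \<and>
     (\<forall>K. compact K \<and> K \<subseteq> U \<longrightarrow> set_integrable lborel K (\<lambda>x. \<bar>f x\<bar> powr p))"

text \<open>\<open>W1p_loc p U v v'\<close> means that \<open>v\<close> is in \<open>W\<^sup>1\<^sup>,\<^sup>p\<^sub>l\<^sub>o\<^sub>c(U)\<close> and that \<open>v'\<close> is a representative
  of its weak derivative on \<open>U\<close>. Only the values of \<open>v\<close> and \<open>v'\<close> on \<open>U\<close> matter.\<close>

definition W1p_loc :: "real \<Rightarrow> real set \<Rightarrow> (real \<Rightarrow> real) \<Rightarrow> (real \<Rightarrow> real) \<Rightarrow> bool" where
  "W1p_loc p U v v' \<longleftrightarrow>
     Lp_loc p U v \<and> Lp_loc p U v' \<and>
     (\<forall>\<phi>. test_function U \<phi> \<longrightarrow>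
        (LINT x:U|lborel. v x * deriv \<phi> x) = - (LINT x:U|lborel. v' x * \<phi> x))"

definition admissible :: "real \<Rightarrow> real \<Rightarrow> real \<Rightarrow> (real \<Rightarrow> real) \<Rightarrow> (real \<Rightarrow> real) \<Rightarrow> bool" where
  "admissible p \<xi> r v v' \<longleftrightarrow>
     W1p_loc p {r<..} v v' \<and> continuous_on {r..} v \<and> v r = \<xi> \<and> (v \<longlongrightarrow> 1) at_top"

definition energy :: "nat \<Rightarrow> real \<Rightarrow> real \<Rightarrow> (real \<Rightarrow> real) \<Rightarrow> (real \<Rightarrow> real) \<Rightarrow> ennreal" where
  "energy d p r v v' =
     (\<integral>\<^sup>+t\<in>{r<..}. ennreal (t ^ (d - 1) * (\<bar>v' t\<bar> powr p + (1 - v t)\<^sup>2)) \<partial>lborel)"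

text \<open>The weak derivative is unique up to null sets and the energy does not see null sets, so
  letting \<open>v'\<close> range over all representatives is the same as taking the infimum over \<open>v\<close>.\<close>

definition q_inf :: "nat \<Rightarrow> real \<Rightarrow> real \<Rightarrow> real \<Rightarrow> ennreal" where
  "q_inf d p \<xi> r = Inf {energy d p r v v' |v v'. admissible p \<xi> r v v'}"

definition f_cost :: "nat \<Rightarrow> real \<Rightarrow> real \<Rightarrow> real \<Rightarrow> real \<Rightarrow> ennreal" where
  "f_cost d p a m r =
     ennreal (a * m\<^sup>2 / (unit_ball_vol d * r ^ d) + unit_ball_vol d * r ^ d)
     + ennreal (d * unit_ball_vol d) * q_inf d p 0 r"

text \<open>\<open>LEAST\<close> denotes a genuine minimum (an attained value), not merely an infimum.\<close>

definition f_min :: "nat \<Rightarrow> real \<Rightarrow> real \<Rightarrow> real \<Rightarrow> ennreal" where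
  "f_min d p a m = (if m = 0 then 0 else (LEAST y. \<exists>r>0. y = f_cost d p a m r))"

definition kappa :: "nat \<Rightarrow> real \<Rightarrow> ennreal" where
  "kappa d p = ennreal (d * unit_ball_vol d) * q_inf d p 0 0"

end

theory Submission
  imports Defs
begin

text \<open>Translating competitors shows that \<open>q_inf\<close> is nondecreasing in the radius and that
  \<open>q_inf s \<le> (s / r) ^ (d - 1) * q_inf r\<close> for \<open>0 < r \<le> s\<close>. Hence \<open>q_inf\<close> is either identically
  infinite or finite and continuous on the positive radii, so the minimum defining \<open>f_min\<close> is
  attained and is at least \<open>kappa\<close>. Conversely, the cost at a fixed small radius \<open>r\<close> tends to
  \<open>\<omega> r ^ d + d \<omega> q_inf r\<close> as \<open>a \<longlonglongrightarrow> 0\<close>, and \<open>q_inf\<close> is right continuous at \<open>0\<close>.\<close>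

section \<open>Translation of test functions\<close>

text \<open>\<open>deriv\<close> selects a value satisfying the \<open>DERIV\<close> predicate, and
  that predicate is translation invariant; so the identity also covers points where \<open>f\<close>
  is not differentiable.\<close>

lemma funpow_deriv_shift:
  "(deriv ^^ n) (\<lambda>x. f (c + x)) = (\<lambda>x. (deriv ^^ n) f (c + x))" for f :: "real \<Rightarrow> real"
  by (induction n) (simp_all add: deriv_def DERIV_shift add.commute[of c])

lemma test_function_shift:
  assumes "test_function U \<phi>"
  shows "test_function ((+) c ` U) (\<lambda>x. \<phi> (- c + x))"
proof -
  have diff: "(\<lambda>x. f (x - c)) differentiable (at x)"
    if "\<And>x. f differentiable (at x)" for f :: "real \<Rightarrow> real" and x
    using differentiable_compose[of f "\<lambda>x. x - c" x UNIV] that by simp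
  have "{x. \<phi> (- c + x) \<noteq> 0} = (+) c ` {x. \<phi> x \<noteq> 0}"
    by (auto intro!: image_eqI[of _ "(+) c" "x - c" for x])
  then have "closure {x. \<phi> (- c + x) \<noteq> 0} = (+) c ` closure {x. \<phi> x \<noteq> 0}"
    by (simp only: closure_translation)
  then show ?thesis
    using assms unfolding test_function_def funpow_deriv_shift
    by (auto intro!: diff compact_translation)
qed

section \<open>Derivatives of test functions\<close>

lemma
  assumes "test_function U \<phi>"
  shows has_field_derivative_test_function: "(\<phi> has_field_derivative deriv \<phi> x) (at x)"
    and continuous_on_deriv_test_function: "continuous_on S (deriv \<phi>)"
proof -
  have "(deriv ^^ n) \<phi> differentiable (at x)" for n x
    using assms unfolding test_function_def by blast
  from this[of 0] this[of 1] have *: "\<phi> differentiable (at x)" "deriv \<phi> differentiable (at x)" for x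
    by simp_all
  show "(\<phi> has_field_derivative deriv \<phi> x) (at x)"
    using *(1)[of x] by (auto simp: real_differentiable_def DERIV_imp_deriv)
  show "continuous_on S (deriv \<phi>)"
    using *(2) by (meson continuous_at_imp_continuous_on differentiable_imp_continuous_within)
qed

text \<open>The complement of the closed support is open and \<open>\<phi>\<close> vanishes on it,
  so \<open>\<phi>\<close> is locally constant there.\<close>

lemma deriv_test_function_outside:
  assumes "x \<notin> closure {x. \<phi> x \<noteq> (0::real)}"
  shows "deriv \<phi> x = 0"
proof -
  have "open (- closure {x. \<phi> x \<noteq> 0})" "x \<in> - closure {x. \<phi> x \<noteq> 0}"
    using assms by auto
  moreover have "0 = \<phi> y" if "y \<in> - closure {x. \<phi> x \<noteq> 0}" for y
    using that closure_subset[of "{x. \<phi> x \<noteq> 0}"] by auto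
  ultimately have "(\<phi> has_field_derivative 0) (at x)"
    by (rule has_field_derivative_transform_within_open[OF DERIV_const])
  then show ?thesis by (rule DERIV_imp_deriv)
qed

text \<open>By the fundamental theorem of calculus on an interval whose endpoints lie outside the
  support. This says that constants have weak derivative \<open>0\<close>, which is how it is used
  for affine images of competitors.\<close>

lemma integral_deriv_test_function:
  assumes "test_function U \<phi>"
  shows "(LINT x:U|lborel. deriv \<phi> x) = 0"
proof -
  let ?C = "closure {x. \<phi> x \<noteq> 0}"
  have C: "compact ?C" "?C \<subseteq> U" using assms by (auto simp: test_function_def)
  obtain b where b: "?C \<subseteq> {-b<..<b}"
  proof -
    obtain b where "?C \<subseteq> ball 0 b"
      using C(1) by (meson bounded_subset_ballD compact_imp_bounded)
    then show thesis using that[of b] by (auto simp: subset_iff dist_real_def abs_less_iff minus_less_iff)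
  qed
  have out: "\<phi> x = 0" if "x \<notin> ?C" for x
    using that closure_subset[of "{x. \<phi> x \<noteq> 0}"] by auto
  \<comment> \<open>If the support is empty, \<open>b\<close> may be negative; the absolute value
    keeps the endpoints in order.\<close>
  have "(LINT x:U|lborel. deriv \<phi> x) = (LINT x|lborel. indicator {- \<bar>b\<bar>..\<bar>b\<bar>} x *\<^sub>R deriv \<phi> x)"
    unfolding set_lebesgue_integral_def
    using b C deriv_test_function_outside[of _ \<phi>]
    by (intro Bochner_Integration.integral_cong refl) (fastforce simp: indicator_def)
  also have "\<dots> = \<phi> \<bar>b\<bar> - \<phi> (- \<bar>b\<bar>)"
    using has_field_derivative_test_function[OF assms]
    by (intro integral_FTC_atLeastAtMost continuous_on_deriv_test_function[OF assms])
      (auto simp: has_real_derivative_iff_has_vector_derivative[symmetric]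
        intro: has_field_derivative_at_within)
  also have "\<dots> = 0"
    using b out[of "\<bar>b\<bar>"] out[of "-\<bar>b\<bar>"] by (force simp: subset_iff)
  finally show ?thesis .
qed

section \<open>Translation of Sobolev functions and competitors\<close>

lemma Lp_loc_shift:
  assumes "Lp_loc p ((+) c ` U) f"
  shows "Lp_loc p U (\<lambda>x. f (c + x))"
  unfolding Lp_loc_def
proof (intro conjI allI impI)
  have ind: "indicator ((+) c ` A) (c + x) = (indicator A x :: real)" for A x
    by (auto simp: indicator_def)
  have "(\<lambda>x. indicator ((+) c ` U) x *\<^sub>R f x) \<in> borel_measurable lborel"
    using assms by (simp add: Lp_loc_def set_borel_measurable_def)
  then have "(\<lambda>x. indicator ((+) c ` U) (c + x) *\<^sub>R f (c + x)) \<in> borel_measurable lborel"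
    by measurable
  then show "set_borel_measurable lborel U (\<lambda>x. f (c + x))"
    by (simp add: set_borel_measurable_def ind)
  fix K assume "compact K \<and> K \<subseteq> U"
  then have "set_integrable lborel ((+) c ` K) (\<lambda>x. \<bar>f x\<bar> powr p)"
    using assms compact_translation[of K c] unfolding Lp_loc_def by (metis image_mono)
  \<comment> \<open>Written with \<open>c + 1 * x\<close> to match the affine change of variables
    with slope 1.\<close>
  then have "integrable lborel (\<lambda>x. indicator ((+) c ` K) (c + 1 * x) *\<^sub>R \<bar>f (c + 1 * x)\<bar> powr p)"
    unfolding set_integrable_def by (intro lborel_integrable_real_affine) simp_all
  then show "set_integrable lborel K (\<lambda>x. \<bar>f (c + x)\<bar> powr p)"
    by (simp add: set_integrable_def ind)
qed

lemma set_integral_shift: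
  "(LINT x:U|lborel. f (c + x)) = (LINT x:(+) c ` U|lborel. f x)" for f :: "real \<Rightarrow> real"
proof -
  have ind: "indicator ((+) c ` U) (c + x) = (indicator U x :: real)" for x
    by (auto simp: indicator_def)
  show ?thesis
    using lborel_integral_real_affine[of 1 "\<lambda>x. indicator ((+) c ` U) x *\<^sub>R f x" c]
    by (simp add: set_lebesgue_integral_def ind)
qed

text \<open>The weak identity against \<open>\<phi>\<close> on \<open>U\<close> is the one against
  the translated test function on the translated set, read after a change of variables.\<close>

lemma W1p_loc_shift:
  assumes "W1p_loc p ((+) c ` U) v v'"
  shows "W1p_loc p U (\<lambda>x. v (c + x)) (\<lambda>x. v' (c + x))"
  unfolding W1p_loc_def
proof (intro conjI allI impI)
  show "Lp_loc p U (\<lambda>x. v (c + x))" "Lp_loc p U (\<lambda>x. v' (c + x))"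
    using assms by (auto simp: W1p_loc_def intro: Lp_loc_shift)
  fix \<phi> assume \<phi>: "test_function U \<phi>"
  define \<psi> where "\<psi> = (\<lambda>x. \<phi> (- c + x))"
  have \<psi>: "test_function ((+) c ` U) \<psi>" "\<phi> x = \<psi> (c + x)" "deriv \<phi> x = deriv \<psi> (c + x)" for x
    using test_function_shift[OF \<phi>, of c] funpow_deriv_shift[of 1 \<phi> "- c"] by (simp_all add: \<psi>_def)
  then show "(LINT x:U|lborel. v (c + x) * deriv \<phi> x) = - (LINT x:U|lborel. v' (c + x) * \<phi> x)"
    using assms set_integral_shift[of U "\<lambda>x. v x * deriv \<psi> x" c]
      set_integral_shift[of U "\<lambda>x. v' x * \<psi> x" c]
    by (simp add: W1p_loc_def)
qed

text \<open>Turns a competitor at radius \<open>r\<close> into one at radius \<open>r - c\<close>,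
  with the same boundary value and limit. The sign of \<open>c\<close> is free: both directions are
  used to compare radii.\<close>

lemma admissible_shift:
  assumes "admissible p \<xi> r v v'"
  shows "admissible p \<xi> (r - c) (\<lambda>x. v (c + x)) (\<lambda>x. v' (c + x))"
proof -
  have "(+) c ` {r - c<..} = {r<..}"
    by (auto intro!: image_eqI[of _ "(+) c" "x - c" for x])
  then have "W1p_loc p {r - c<..} (\<lambda>x. v (c + x)) (\<lambda>x. v' (c + x))"
    using assms by (intro W1p_loc_shift) (simp add: admissible_def)
  moreover have "continuous_on {r - c..} (\<lambda>x. v (c + x))"
  proof (rule continuous_on_compose2[of "{r..}" v])
    show "continuous_on {r..} v" using assms by (simp add: admissible_def)
  qed (auto intro: continuous_on_add)
  moreover have "((\<lambda>x. v (c + x)) \<longlongrightarrow> 1) at_top"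
  proof (rule filterlim_compose[of v _ at_top "(+) c"])
    show "(v \<longlongrightarrow> 1) at_top" using assms by (simp add: admissible_def)
    show "filterlim ((+) c) at_top at_top"
      by (rule filterlim_tendsto_add_at_top[OF tendsto_const filterlim_ident])
  qed
  ultimately show ?thesis using assms by (simp add: admissible_def)
qed

section \<open>Restriction and affine change of competitors\<close>

text \<open>The condition \<open>\<alpha> + \<beta> = 1\<close> makes the affine map fix the limit
  value 1, while the value at the new left endpoint can still be adjusted. The weak identity follows
  by linearity, since test functions on the smaller half-line are test functions on the larger one
  and the constant \<open>\<beta>\<close> contributes nothing.\<close>

lemma admissible_restrict_affine:
  assumes adm: "admissible p \<xi> r v v'" and "r < s" and "\<alpha> + \<beta> = 1" and "p > 0"
  shows "admissible p (\<alpha> * v s + \<beta>) s (\<lambda>x. \<alpha> * v x + \<beta>) (\<lambda>x. \<alpha> * v' x)"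
proof -
  have W: "W1p_loc p {r<..} v v'" and cont: "continuous_on {r..} v" and lim: "(v \<longlongrightarrow> 1) at_top"
    using adm by (auto simp: admissible_def)
  have cw: "continuous_on A (\<lambda>x. \<alpha> * v x + \<beta>)" if "A \<subseteq> {s..}" for A
    using that \<open>r < s\<close> by (intro continuous_intros continuous_on_subset[OF cont]) auto
  have "Lp_loc p {s<..} (\<lambda>x. \<alpha> * v x + \<beta>)"
    unfolding Lp_loc_def
  proof (intro conjI allI impI)
    show "set_borel_measurable lborel {s<..} (\<lambda>x. \<alpha> * v x + \<beta>)"
      using borel_measurable_continuous_on_indicator[of "{s<..}", OF _ cw]
      by (simp add: set_borel_measurable_def subset_iff)
    fix K assume K: "compact K \<and> K \<subseteq> {s<..}"
    then have "continuous_on K (\<lambda>x. \<alpha> * v x + \<beta>)" by (intro cw) auto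
    with K show "set_integrable lborel K (\<lambda>x. \<bar>\<alpha> * v x + \<beta>\<bar> powr p)"
      unfolding set_integrable_def using \<open>p > 0\<close>
      by (intro borel_integrable_compact continuous_on_powr' continuous_on_rabs continuous_on_const) auto
  qed
  moreover have "Lp_loc p {s<..} (\<lambda>x. \<alpha> * v' x)"
    unfolding Lp_loc_def
  proof (intro conjI allI impI)
    have "(\<lambda>x. indicator {r<..} x *\<^sub>R v' x) \<in> borel_measurable lborel"
      using W by (simp add: W1p_loc_def Lp_loc_def set_borel_measurable_def)
    then have "(\<lambda>x. \<alpha> * (indicator {s<..} x * (indicator {r<..} x *\<^sub>R v' x))) \<in> borel_measurable lborel"
      by measurable
    also have "(\<lambda>x. \<alpha> * (indicator {s<..} x * (indicator {r<..} x *\<^sub>R v' x))) = (\<lambda>x. indicator {s<..} x *\<^sub>R (\<alpha> * v' x))"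
      using \<open>r < s\<close> by (auto simp: indicator_def)
    finally show "set_borel_measurable lborel {s<..} (\<lambda>x. \<alpha> * v' x)"
      by (simp add: set_borel_measurable_def)
    fix K assume "compact K \<and> K \<subseteq> {s<..}"
    then have "compact K \<and> K \<subseteq> {r<..}" using \<open>r < s\<close> by auto
    then have "set_integrable lborel K (\<lambda>x. \<bar>v' x\<bar> powr p)"
      using W by (simp add: W1p_loc_def Lp_loc_def)
    then show "set_integrable lborel K (\<lambda>x. \<bar>\<alpha> * v' x\<bar> powr p)"
      by (simp add: abs_mult powr_mult)
  qed
  moreover have "(LINT x:{s<..}|lborel. (\<alpha> * v x + \<beta>) * deriv \<phi> x) = - (LINT x:{s<..}|lborel. \<alpha> * v' x * \<phi> x)"
    if \<phi>: "test_function {s<..} \<phi>" for \<phi>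
  proof -
    let ?C = "closure {x. \<phi> x \<noteq> 0}"
    have C: "compact ?C" "?C \<subseteq> {s<..}" using \<phi> by (auto simp: test_function_def)
    have out: "\<phi> x = 0" "deriv \<phi> x = 0" if "x \<notin> ?C" for x
      using that closure_subset[of "{x. \<phi> x \<noteq> 0}"] deriv_test_function_outside[of x \<phi>] by auto
    have "test_function {r<..} \<phi>"
      using \<phi> \<open>r < s\<close> by (auto simp: test_function_def)
    then have eq: "(LINT x:{r<..}|lborel. v x * deriv \<phi> x) = - (LINT x:{r<..}|lborel. v' x * \<phi> x)"
      using W by (simp add: W1p_loc_def)
    have restr: "(LINT x:{r<..}|lborel. g x) = (LINT x:{s<..}|lborel. g x)"
      if "\<And>x. x \<notin> ?C \<Longrightarrow> g x = 0" for g :: "real \<Rightarrow> real"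
      unfolding set_lebesgue_integral_def using that C(2) \<open>r < s\<close>
      by (intro Bochner_Integration.integral_cong refl) (fastforce simp: indicator_def)
    \<comment> \<open>Splitting the integral of a sum requires integrable summands; continuity on
      the compact support provides this.\<close>
    have intg: "set_integrable lborel {s<..} (\<lambda>x. g x * deriv \<phi> x)" if "continuous_on ?C g" for g
    proof -
      have "integrable lborel (\<lambda>x. indicator ?C x *\<^sub>R (g x * deriv \<phi> x))"
        using that C by (intro borel_integrable_compact continuous_intros continuous_on_deriv_test_function[OF \<phi>])
      also have "(\<lambda>x. indicator ?C x *\<^sub>R (g x * deriv \<phi> x)) = (\<lambda>x. indicator {s<..} x *\<^sub>R (g x * deriv \<phi> x))"
      proof
        fix x
        show "indicator ?C x *\<^sub>R (g x * deriv \<phi> x) = indicator {s<..} x *\<^sub>R (g x * deriv \<phi> x)"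
          using C(2) out(2)[of x] by (cases "x \<in> ?C") (auto simp: subset_iff)
      qed
      finally show ?thesis by (simp add: set_integrable_def)
    qed
    have cv: "continuous_on ?C v"
      using C(2) \<open>r < s\<close> by (intro continuous_on_subset[OF cont]) auto
    have "(LINT x:{s<..}|lborel. (\<alpha> * v x + \<beta>) * deriv \<phi> x)
      = (LINT x:{s<..}|lborel. \<alpha> * (v x * deriv \<phi> x) + \<beta> * (1 * deriv \<phi> x))"
      by (simp add: distrib_right mult.assoc)
    also have "\<dots> = (LINT x:{s<..}|lborel. \<alpha> * (v x * deriv \<phi> x)) + (LINT x:{s<..}|lborel. \<beta> * (1 * deriv \<phi> x))"
      by (intro set_integral_add set_integrable_mult_right impI intg cv continuous_on_const)
    also have "\<dots> = \<alpha> * (LINT x:{s<..}|lborel. v x * deriv \<phi> x)"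
      by (simp add: integral_deriv_test_function[OF \<phi>])
    also have "\<dots> = \<alpha> * - (LINT x:{s<..}|lborel. v' x * \<phi> x)"
    proof -
      have "(LINT x:{r<..}|lborel. v x * deriv \<phi> x) = (LINT x:{s<..}|lborel. v x * deriv \<phi> x)"
        by (rule restr) (metis out(2) mult_zero_right)
      moreover have "(LINT x:{r<..}|lborel. v' x * \<phi> x) = (LINT x:{s<..}|lborel. v' x * \<phi> x)"
        by (rule restr) (metis out(1) mult_zero_right)
      ultimately show ?thesis using eq by simp
    qed
    finally show ?thesis by (simp add: mult.assoc)
  qed
  moreover have "((\<lambda>x. \<alpha> * v x + \<beta>) \<longlongrightarrow> 1) at_top"
    using tendsto_add[OF tendsto_mult[OF tendsto_const lim] tendsto_const, of \<alpha> \<beta>] \<open>\<alpha> + \<beta> = 1\<close> by simp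
  ultimately show ?thesis
    using cw[of "{s..}"] by (simp add: admissible_def W1p_loc_def)
qed

section \<open>Behaviour of the energy under these operations\<close>

text \<open>\<open>v\<close> and \<open>v'\<close> are known to be measurable only on
  \<open>U\<close>, so they are replaced by their cut-offs, which give the same density. The weight
  \<open>g\<close> is left general to include the translated weight of
  \<open>energy_shift\<close>.\<close>

lemma borel_measurable_energy_density:
  assumes "W1p_loc p U v v'" and [measurable]: "g \<in> borel_measurable borel" "U \<in> sets borel"
  shows "(\<lambda>t. ennreal (g t * (\<bar>v' t\<bar> powr p + (1 - v t)\<^sup>2)) * indicator U t) \<in> borel_measurable borel"
proof -
  define w w' where "w = (\<lambda>t. indicator U t *\<^sub>R v t)" and "w' = (\<lambda>t. indicator U t *\<^sub>R v' t)"
  have [measurable]: "w \<in> borel_measurable borel" "w' \<in> borel_measurable borel"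
    using assms(1) by (simp_all add: W1p_loc_def Lp_loc_def set_borel_measurable_def w_def w'_def)
  have "(\<lambda>t. ennreal (g t * (\<bar>w' t\<bar> powr p + (1 - w t)\<^sup>2)) * indicator U t) \<in> borel_measurable borel"
    by measurable
  also have "(\<lambda>t. ennreal (g t * (\<bar>w' t\<bar> powr p + (1 - w t)\<^sup>2)) * indicator U t)
    = (\<lambda>t. ennreal (g t * (\<bar>v' t\<bar> powr p + (1 - v t)\<^sup>2)) * indicator U t)"
    by (auto simp: w_def w'_def indicator_def)
  finally show ?thesis .
qed

text \<open>Substituting \<open>t = c + x\<close> moves the translation onto the weight, so
  comparing the two energies amounts to comparing weights.\<close>

lemma energy_shift:
  assumes "admissible p \<xi> r v v'"
  shows "energy d p (r - c) (\<lambda>x. v (c + x)) (\<lambda>x. v' (c + x))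
    = (\<integral>\<^sup>+t\<in>{r<..}. ennreal ((t - c) ^ (d - 1) * (\<bar>v' t\<bar> powr p + (1 - v t)\<^sup>2)) \<partial>lborel)"
proof -
  have W: "W1p_loc p {r<..} v v'" using assms by (simp add: admissible_def)
  have ind: "indicator {r<..} (c + x) = (indicator {r - c<..} x :: ennreal)" for x
    by (auto simp: indicator_def)
  have "(\<lambda>t. (t - c) ^ (d - 1)) \<in> borel_measurable borel" by simp
  from nn_integral_real_affine[OF borel_measurable_energy_density[OF W this], of 1 c]
  show ?thesis by (simp add: energy_def ind)
qed

lemma energy_mult_left:
  assumes "W1p_loc p {r<..} v v'"
  shows "(\<integral>\<^sup>+t\<in>{r<..}. K * ennreal (t ^ (d - 1) * (\<bar>v' t\<bar> powr p + (1 - v t)\<^sup>2)) \<partial>lborel)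
    = K * energy d p r v v'"
  using nn_integral_cmult[of "\<lambda>t. ennreal (t ^ (d - 1) * (\<bar>v' t\<bar> powr p + (1 - v t)\<^sup>2)) * indicator {r<..} t" lborel K]
    borel_measurable_energy_density[OF assms, of "\<lambda>t. t ^ (d - 1)"]
  by (simp add: energy_def mult.assoc)

text \<open>Since \<open>\<alpha> + \<beta> = 1\<close>, the quantity \<open>1 - v\<close> is
  multiplied by \<open>\<alpha>\<close>, just like the derivative. The two terms scale by different
  powers of \<open>\<alpha>\<close>, and \<open>K\<close> dominates both factors.\<close>

lemma energy_restrict_affine:
  assumes adm: "admissible p \<xi> r v v'" and "0 \<le> r" "r < s" and ab: "\<alpha> + \<beta> = 1"
    and K: "\<bar>\<alpha>\<bar> powr p \<le> K" "\<alpha>\<^sup>2 \<le> K"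
  shows "energy d p s (\<lambda>x. \<alpha> * v x + \<beta>) (\<lambda>x. \<alpha> * v' x) \<le> ennreal K * energy d p r v v'"
proof -
  have "K \<ge> 0" using K(2) zero_le_power2 order_trans by blast
  have *: "t ^ (d - 1) * (\<bar>\<alpha> * v' t\<bar> powr p + (1 - (\<alpha> * v t + \<beta>))\<^sup>2)
      \<le> K * (t ^ (d - 1) * (\<bar>v' t\<bar> powr p + (1 - v t)\<^sup>2))" if "t > s" for t
  proof -
    have eq: "1 - (\<alpha> * v t + \<beta>) = \<alpha> * (1 - v t)" using ab by (simp add: algebra_simps)
    have "\<bar>\<alpha> * v' t\<bar> powr p + (1 - (\<alpha> * v t + \<beta>))\<^sup>2 = \<bar>\<alpha>\<bar> powr p * \<bar>v' t\<bar> powr p + \<alpha>\<^sup>2 * (1 - v t)\<^sup>2"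
      by (simp only: eq abs_mult powr_mult power_mult_distrib abs_ge_zero)
    also have "\<dots> \<le> K * \<bar>v' t\<bar> powr p + K * (1 - v t)\<^sup>2"
      using K by (intro add_mono mult_right_mono) auto
    finally have "t ^ (d - 1) * (\<bar>\<alpha> * v' t\<bar> powr p + (1 - (\<alpha> * v t + \<beta>))\<^sup>2)
        \<le> t ^ (d - 1) * (K * \<bar>v' t\<bar> powr p + K * (1 - v t)\<^sup>2)"
      using that \<open>0 \<le> r\<close> \<open>r < s\<close> by (intro mult_left_mono) auto
    then show ?thesis by (simp add: algebra_simps)
  qed
  have "energy d p s (\<lambda>x. \<alpha> * v x + \<beta>) (\<lambda>x. \<alpha> * v' x)
    \<le> (\<integral>\<^sup>+t\<in>{r<..}. ennreal K * ennreal (t ^ (d - 1) * (\<bar>v' t\<bar> powr p + (1 - v t)\<^sup>2)) \<partial>lborel)"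
    unfolding energy_def
  proof (intro nn_integral_mono)
    fix t
    show "ennreal (t ^ (d - 1) * (\<bar>\<alpha> * v' t\<bar> powr p + (1 - (\<alpha> * v t + \<beta>))\<^sup>2)) * indicator {s<..} t
      \<le> ennreal K * ennreal (t ^ (d - 1) * (\<bar>v' t\<bar> powr p + (1 - v t)\<^sup>2)) * indicator {r<..} t"
      using *[of t] \<open>r < s\<close> ennreal_leI[OF *[of t]] ennreal_mult'[OF \<open>K \<ge> 0\<close>]
      by (auto simp: indicator_def)
  qed
  also have "\<dots> = ennreal K * energy d p r v v'"
    using adm by (intro energy_mult_left) (simp add: admissible_def)
  finally show ?thesis .
qed

section \<open>Dependence of \<open>q_inf\<close> on the radius\<close>

lemma q_inf_le_energy: "admissible p \<xi> r v v' \<Longrightarrow> q_inf d p \<xi> r \<le> energy d p r v v'"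
  unfolding q_inf_def by (intro Inf_lower) auto

text \<open>Each competitor at radius \<open>r\<close>, once translated, is a competitor at radius
  \<open>r - c\<close>, and the pointwise bound on the weights bounds its energy.\<close>

lemma q_inf_shift_le:
  assumes "K > 0" and K: "\<And>t. r < t \<Longrightarrow> (t - c) ^ (d - 1) \<le> K * t ^ (d - 1)"
  shows "q_inf d p \<xi> (r - c) \<le> ennreal K * q_inf d p \<xi> r"
proof -
  have step: "q_inf d p \<xi> (r - c) \<le> ennreal K * energy d p r v v'" if adm: "admissible p \<xi> r v v'" for v v'
  proof -
    have "q_inf d p \<xi> (r - c) \<le> energy d p (r - c) (\<lambda>x. v (c + x)) (\<lambda>x. v' (c + x))"
      by (intro q_inf_le_energy admissible_shift adm)
    also have "\<dots> \<le> (\<integral>\<^sup>+t\<in>{r<..}. ennreal K * ennreal (t ^ (d - 1) * (\<bar>v' t\<bar> powr p + (1 - v t)\<^sup>2)) \<partial>lborel)"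
      unfolding energy_shift[OF adm]
    proof (intro nn_integral_mono)
      fix t
      show "ennreal ((t - c) ^ (d - 1) * (\<bar>v' t\<bar> powr p + (1 - v t)\<^sup>2)) * indicator {r<..} t
        \<le> ennreal K * ennreal (t ^ (d - 1) * (\<bar>v' t\<bar> powr p + (1 - v t)\<^sup>2)) * indicator {r<..} t"
      proof (cases "r < t")
        case True
        then have "(t - c) ^ (d - 1) * (\<bar>v' t\<bar> powr p + (1 - v t)\<^sup>2)
            \<le> K * t ^ (d - 1) * (\<bar>v' t\<bar> powr p + (1 - v t)\<^sup>2)"
          by (intro mult_right_mono K) auto
        with True \<open>K > 0\<close> show ?thesis
          by (simp add: ennreal_mult'[symmetric] mult.assoc ennreal_leI)
      qed simp
    qed
    also have "\<dots> = ennreal K * energy d p r v v'"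
      using adm by (intro energy_mult_left) (simp add: admissible_def)
    finally show ?thesis .
  qed
  \<comment> \<open>To pass to the infimum, \<open>K\<close> is moved to the left as
    \<open>inverse K\<close>, so that \<open>Inf_greatest\<close> applies, and is then multiplied
    back.\<close>
  have inv: "ennreal (inverse K) * ennreal K = 1" "ennreal K * ennreal (inverse K) = 1"
    using \<open>K > 0\<close> by (simp_all add: ennreal_mult'[symmetric])
  have "ennreal (inverse K) * q_inf d p \<xi> (r - c) \<le> q_inf d p \<xi> r"
  proof (subst (2) q_inf_def, rule Inf_greatest)
    fix E assume "E \<in> {energy d p r v v' |v v'. admissible p \<xi> r v v'}"
    then obtain v v' where "E = energy d p r v v'" "admissible p \<xi> r v v'" by auto
    then have "ennreal (inverse K) * q_inf d p \<xi> (r - c) \<le> ennreal (inverse K) * (ennreal K * E)"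
      using step by (intro mult_left_mono) auto
    then show "ennreal (inverse K) * q_inf d p \<xi> (r - c) \<le> E"
      by (simp add: mult.assoc[symmetric] inv)
  qed
  then have "ennreal K * (ennreal (inverse K) * q_inf d p \<xi> (r - c)) \<le> ennreal K * q_inf d p \<xi> r"
    by (intro mult_left_mono) auto
  then show ?thesis by (simp add: mult.assoc[symmetric] inv)
qed

text \<open>Translating to the left by \<open>r - s\<close> does not increase the weight, so the
  factor is \<open>K = 1\<close>.\<close>

lemma q_inf_mono:
  assumes "0 \<le> s" "s \<le> r"
  shows "q_inf d p \<xi> s \<le> q_inf d p \<xi> r"
  using q_inf_shift_le[of 1 r "r - s" d p \<xi>] assms by (simp add: power_mono)

text \<open>Translating to the right by \<open>s - r\<close> multiplies \<open>t\<close> by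
  \<open>(t + s - r) / t\<close>, which is nonincreasing in \<open>t\<close> and equals
  \<open>s / r\<close> at \<open>t = r\<close>.\<close>

lemma q_inf_growth:
  assumes "0 < r" "r \<le> s"
  shows "q_inf d p \<xi> s \<le> ennreal ((s / r) ^ (d - 1)) * q_inf d p \<xi> r"
proof -
  have "(t - (r - s)) ^ (d - 1) \<le> (s / r) ^ (d - 1) * t ^ (d - 1)" if "r < t" for t
  proof -
    have "(s - r) * r \<le> (s - r) * t" using assms that by (intro mult_left_mono) auto
    then have "t - (r - s) \<le> s / r * t" using assms by (simp add: field_simps)
    then show ?thesis
      using assms that unfolding power_mult_distrib[symmetric] by (intro power_mono) auto
  qed
  then show ?thesis using q_inf_shift_le[of "(s / r) ^ (d - 1)" r "r - s" d p \<xi>] assms by simp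
qed

text \<open>For a competitor \<open>v\<close> at radius \<open>0\<close>, the function \<open>(v - v s) / (1 - v s)\<close> is a competitor at
  radius \<open>s\<close>, and its energy exceeds that of \<open>v\<close> by a factor tending to \<open>1\<close>.\<close>

lemma tendsto_q_inf_at_right_0:
  assumes "p > 0"
  shows "(q_inf d p 0 \<longlongrightarrow> q_inf d p 0 0) (at_right 0)"
proof (rule order_tendstoI)
  fix y assume "y < q_inf d p 0 0"
  then have "y < q_inf d p 0 s" if "s > 0" for s
    using q_inf_mono[of 0 s d p 0] that by (auto intro: less_le_trans)
  then show "eventually (\<lambda>s. y < q_inf d p 0 s) (at_right 0)"
    by (intro eventually_mono[OF eventually_at_right_less])
next
  fix y assume "q_inf d p 0 0 < y"
  \<comment> \<open>A nearly optimal competitor is fixed before the radius varies; its energy is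
    finite because it lies below \<open>y\<close>.\<close>
  then obtain v v' where adm: "admissible p 0 0 v v'" and E: "energy d p 0 v v' < y"
    unfolding q_inf_def Inf_less_iff by auto
  have "continuous_on {0..} v" "v 0 = 0" using adm by (auto simp: admissible_def)
  then have "(v \<longlongrightarrow> 0) (at 0 within {0..})"
    unfolding continuous_on_def by force
  then have v: "(v \<longlongrightarrow> 0) (at_right 0)"
    by (rule tendsto_within_subset) auto
  \<comment> \<open>The smallest constant allowed by \<open>energy_restrict_affine\<close> for the
    factor \<open>1 / (1 - v s)\<close>; it tends to 1 because \<open>v s\<close> tends to
    \<open>v 0 = 0\<close>.\<close>
  define K where "K s = max (\<bar>1 / (1 - v s)\<bar> powr p) ((1 / (1 - v s))\<^sup>2)" for s
  have "(K \<longlongrightarrow> max (\<bar>1 / (1 - 0)\<bar> powr p) ((1 / (1 - 0))\<^sup>2)) (at_right 0)"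
    unfolding K_def using v by (intro tendsto_intros) auto
  then have "((\<lambda>s. ennreal (K s)) \<longlongrightarrow> ennreal 1) (at_right 0)"
    by (intro tendsto_ennrealI) simp
  then have "((\<lambda>s. ennreal (K s) * energy d p 0 v v') \<longlongrightarrow> ennreal 1 * energy d p 0 v v') (at_right 0)"
    using E by (intro tendsto_mult_ennreal tendsto_const) auto
  then have "eventually (\<lambda>s. ennreal (K s) * energy d p 0 v v' < y) (at_right 0)"
    using E by (auto dest: order_tendstoD)
  moreover have "eventually (\<lambda>s. v s < 1) (at_right 0)"
    using v by (rule order_tendstoD) simp
  moreover have "eventually (\<lambda>s::real. 0 < s) (at_right 0)"
    by (rule eventually_at_right_less)
  ultimately show "eventually (\<lambda>s. q_inf d p 0 s < y) (at_right 0)"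
  proof eventually_elim
    case (elim s)
    define \<alpha> where "\<alpha> = 1 / (1 - v s)"
    have \<alpha>: "\<alpha> * v s + (1 - \<alpha>) = 0" using elim by (simp add: \<alpha>_def field_simps)
    have "admissible p 0 s (\<lambda>x. \<alpha> * v x + (1 - \<alpha>)) (\<lambda>x. \<alpha> * v' x)"
      using admissible_restrict_affine[OF adm, of s \<alpha> "1 - \<alpha>"] elim \<open>p > 0\<close> by (simp add: \<alpha>)
    then have "q_inf d p 0 s \<le> energy d p s (\<lambda>x. \<alpha> * v x + (1 - \<alpha>)) (\<lambda>x. \<alpha> * v' x)"
      by (rule q_inf_le_energy)
    also have "\<dots> \<le> ennreal (K s) * energy d p 0 v v'"
      using elim by (intro energy_restrict_affine[OF adm]) (auto simp: K_def \<alpha>_def)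
    also have "\<dots> < y" using elim by simp
    finally show ?case .
  qed
qed

text \<open>Finiteness passes to larger radii by \<open>q_inf_growth\<close> and to smaller ones by
  \<open>q_inf_mono\<close>.\<close>

lemma q_inf_finite_everywhere:
  assumes "0 < r" "0 < s" "q_inf d p \<xi> r < top"
  shows "q_inf d p \<xi> s < top"
proof (cases "r \<le> s")
  case True
  with assms q_inf_growth[OF \<open>0 < r\<close> True, of d p \<xi>] show ?thesis
    by (auto simp: ennreal_mult_less_top intro: le_less_trans)
next
  case False
  with assms q_inf_mono[of s r d p \<xi>] show ?thesis by auto
qed

text \<open>Monotonicity and growth together squeeze the value at \<open>r\<close> between two
  multiples of the value at \<open>s\<close> whose factors tend to 1 as \<open>r\<close> tends to
  \<open>s\<close>. The \<open>min\<close> and \<open>max\<close> let one pair of bounds serve both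
  sides of \<open>s\<close>.\<close>

lemma continuous_on_q_inf:
  assumes fin: "\<And>r. r > 0 \<Longrightarrow> q_inf d p \<xi> r < top"
  shows "continuous_on {0<..} (\<lambda>r. enn2real (q_inf d p \<xi> r))"
  unfolding continuous_on_def
proof
  fix s :: real assume "s \<in> {0<..}"
  then have "s > 0" by simp
  define Q where "Q r = enn2real (q_inf d p \<xi> r)" for r
  have q: "q_inf d p \<xi> r = ennreal (Q r)" if "r > 0" for r
    using fin[OF that] by (simp add: Q_def)
  have Q0: "Q r \<ge> 0" for r by (simp add: Q_def)
  have mono: "Q x \<le> Q y" if "0 < x" "x \<le> y" for x y
    using q_inf_mono[of x y d p \<xi>] that by (simp add: q Q0)
  have growth: "Q y \<le> (y / x) ^ (d - 1) * Q x" if "0 < x" "x \<le> y" for x y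
    using q_inf_growth[of x y d p \<xi>] that by (simp add: q Q0 ennreal_mult'[symmetric])
  have ev: "eventually (\<lambda>r. r > 0) (at s within {0<..})"
    by (simp add: eventually_at_filter)
  show "((\<lambda>r. enn2real (q_inf d p \<xi> r)) \<longlongrightarrow> enn2real (q_inf d p \<xi> s)) (at s within {0<..})"
    unfolding Q_def[symmetric]
  proof (rule tendsto_sandwich)
    show "eventually (\<lambda>r. min 1 ((r / s) ^ (d - 1)) * Q s \<le> Q r) (at s within {0<..})"
      using ev
    proof eventually_elim
      case (elim r)
      show ?case
      proof (cases "r \<le> s")
        case True
        \<comment> \<open>For \<open>r \<le> s\<close> the lower bound is the growth estimate from
          \<open>r\<close> to \<open>s\<close>, solved for \<open>Q r\<close>.\<close>
        have "(r / s) ^ (d - 1) * Q s \<le> (r / s) ^ (d - 1) * ((s / r) ^ (d - 1) * Q r)"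
          using growth[OF elim True] elim \<open>s > 0\<close> by (intro mult_left_mono) auto
        also have "\<dots> = Q r"
          using elim \<open>s > 0\<close> by (simp add: mult.assoc[symmetric] power_mult_distrib[symmetric])
        finally show ?thesis
          using mult_right_mono[OF min.cobounded2, of "Q s" 1 "(r / s) ^ (d - 1)"] Q0[of s] by linarith
      next
        case False
        then show ?thesis
          using mult_right_mono[OF min.cobounded1, of "Q s" 1 "(r / s) ^ (d - 1)"] Q0[of s] mono[of s r] \<open>s > 0\<close>
          by linarith
      qed
    qed
    show "eventually (\<lambda>r. Q r \<le> max 1 ((r / s) ^ (d - 1)) * Q s) (at s within {0<..})"
      using ev
    proof eventually_elim
      case (elim r)
      show ?case
      proof (cases "r \<le> s")
        case True
        then show ?thesis
          using mult_right_mono[OF max.cobounded1, of "Q s" 1 "(r / s) ^ (d - 1)"] Q0[of s] mono[of r s] elim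
          by linarith
      next
        case False
        then show ?thesis
          using mult_right_mono[OF max.cobounded2, of "Q s" "(r / s) ^ (d - 1)" 1] Q0[of s] growth[of s r] \<open>s > 0\<close>
          by linarith
      qed
    qed
    have "((\<lambda>r. min 1 ((r / s) ^ (d - 1)) * Q s) \<longlongrightarrow> min 1 ((s / s) ^ (d - 1)) * Q s) (at s within {0<..})"
      "((\<lambda>r. max 1 ((r / s) ^ (d - 1)) * Q s) \<longlongrightarrow> max 1 ((s / s) ^ (d - 1)) * Q s) (at s within {0<..})"
      using \<open>s > 0\<close> by (intro tendsto_intros; simp)+
    then show "((\<lambda>r. min 1 ((r / s) ^ (d - 1)) * Q s) \<longlongrightarrow> Q s) (at s within {0<..})"
      "((\<lambda>r. max 1 ((r / s) ^ (d - 1)) * Q s) \<longlongrightarrow> Q s) (at s within {0<..})"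
      using \<open>s > 0\<close> by simp_all
  qed
qed

section \<open>Existence of a minimizing radius\<close>

lemma attains_inf_coercive:
  fixes G :: "real \<Rightarrow> real"
  assumes cont: "continuous_on {0<..} G" and lim: "filterlim G at_top (at_right 0)" "filterlim G at_top at_top"
  shows "\<exists>r>0. \<forall>s>0. G r \<le> G s"
proof -
  obtain l where l: "l > 0" "\<And>s. 0 < s \<Longrightarrow> s < l \<Longrightarrow> G 1 \<le> G s"
    using filterlim_at_top[THEN iffD1, OF lim(1), rule_format, of "G 1"]
    unfolding eventually_at_right_field by auto
  obtain u where u: "\<And>s. u \<le> s \<Longrightarrow> G 1 \<le> G s"
    using filterlim_at_top[THEN iffD1, OF lim(2), rule_format, of "G 1"]
    unfolding eventually_at_top_linorder by auto
  \<comment> \<open>Including 1 in the interval ensures that its minimum is at most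
    \<open>G 1\<close>, hence at most every value outside.\<close>
  let ?I = "{min l 1..max u 1}"
  have "?I \<subseteq> {0<..}" using \<open>l > 0\<close> by auto
  then have "\<exists>r\<in>?I. \<forall>s\<in>?I. G r \<le> G s"
    using continuous_on_subset[OF cont] by (intro continuous_attains_inf) auto
  then obtain r where r: "r \<in> ?I" "\<And>s. s \<in> ?I \<Longrightarrow> G r \<le> G s"
    by blast
  have "G r \<le> G s" if "s > 0" for s
  proof (cases "s \<in> ?I")
    case False
    then have "G 1 \<le> G s" using l u that by (auto simp: not_le)
    moreover have "G r \<le> G 1" by (intro r) auto
    ultimately show ?thesis by linarith
  qed (rule r)
  moreover have "r > 0" using r(1) \<open>?I \<subseteq> {0<..}\<close> by blast
  ultimately show ?thesis by blast
qed

text \<open>If \<open>q_inf\<close> is finite, the cost is a continuous real function that blows up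
  at \<open>0\<close> through the term with \<open>m\<close> and at infinity through the volume
  term. Otherwise the cost is \<open>top\<close> at every positive radius and any radius is a
  minimizer.\<close>

lemma f_cost_attains_min:
  assumes "d \<ge> 1" "a > 0" "m > 0"
  shows "\<exists>r>0. \<forall>s>0. f_cost d p a m r \<le> f_cost d p a m s"
proof (cases "q_inf d p 0 1 < top")
  case True
  define \<omega> where "\<omega> = unit_ball_vol (real d)"
  have "\<omega> > 0" by (simp add: \<omega>_def)
  have fin: "q_inf d p 0 r < top" if "r > 0" for r
    using q_inf_finite_everywhere[OF _ that True] by simp
  define g where "g r = a * m\<^sup>2 / (\<omega> * r ^ d) + \<omega> * r ^ d" for r
  define G where "G r = g r + d * \<omega> * enn2real (q_inf d p 0 r)" for r
  have g0: "g r \<ge> 0" if "r > 0" for r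
    using that \<open>\<omega> > 0\<close> \<open>a > 0\<close> by (simp add: g_def)
  have cost: "f_cost d p a m r = ennreal (G r)" if "r > 0" for r
  proof -
    have "f_cost d p a m r = ennreal (g r) + ennreal (d * \<omega>) * ennreal (enn2real (q_inf d p 0 r))"
      using fin[OF that] by (simp add: f_cost_def g_def \<omega>_def)
    then show ?thesis
      using g0[OF that] \<open>\<omega> > 0\<close> by (simp add: G_def ennreal_mult'[symmetric] ennreal_plus)
  qed
  have g_le_G: "g r \<le> G r" for r using \<open>\<omega> > 0\<close> by (simp add: G_def)
  \<comment> \<open>The approach to \<open>0\<close> must be through positive values for the inverse
    to tend to plus infinity.\<close>
  have "filterlim (\<lambda>r::real. r ^ d) (at_right 0) (at_right 0)"
    using \<open>d \<ge> 1\<close> unfolding filterlim_at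
    by (auto intro!: tendsto_eq_intros eventually_at_right_less[THEN eventually_mono])
  then have "filterlim (\<lambda>r. inverse (r ^ d)) at_top (at_right (0::real))"
    by (rule filterlim_compose[OF filterlim_inverse_at_top_right])
  then have "filterlim (\<lambda>r. a * m\<^sup>2 / \<omega> * inverse (r ^ d)) at_top (at_right 0)"
    using assms \<open>\<omega> > 0\<close> by (intro filterlim_tendsto_pos_mult_at_top[OF tendsto_const]) auto
  then have "filterlim G at_top (at_right 0)"
  proof (rule filterlim_at_top_mono)
    have "a * m\<^sup>2 / \<omega> * inverse (r ^ d) \<le> G r" if "r > 0" for r
    proof -
      have "0 \<le> \<omega> * r ^ d" using that \<open>\<omega> > 0\<close> by simp
      then have "a * m\<^sup>2 / (\<omega> * r ^ d) \<le> G r" using g_le_G[of r] by (simp add: g_def)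
      then show ?thesis by (simp add: divide_inverse mult.assoc)
    qed
    then show "eventually (\<lambda>r. a * m\<^sup>2 / \<omega> * inverse (r ^ d) \<le> G r) (at_right 0)"
      by (intro eventually_mono[OF eventually_at_right_less])
  qed
  moreover have "filterlim (\<lambda>r. \<omega> * r ^ d) at_top at_top"
    using \<open>d \<ge> 1\<close> \<open>\<omega> > 0\<close>
    by (intro filterlim_tendsto_pos_mult_at_top[OF tendsto_const] filterlim_pow_at_top filterlim_ident) auto
  then have "filterlim G at_top at_top"
  proof (rule filterlim_at_top_mono)
    have "\<omega> * r ^ d \<le> G r" if "r > 0" for r
    proof -
      have "0 \<le> a * m\<^sup>2 / (\<omega> * r ^ d)" using that \<open>\<omega> > 0\<close> \<open>a > 0\<close> by simp
      then show ?thesis using g_le_G[of r] by (simp add: g_def)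
    qed
    then show "eventually (\<lambda>r. \<omega> * r ^ d \<le> G r) at_top"
      by (intro eventually_mono[OF eventually_gt_at_top])
  qed
  moreover have "continuous_on {0<..} G"
    unfolding G_def g_def using \<open>\<omega> > 0\<close>
    by (intro continuous_intros continuous_on_q_inf fin) auto
  ultimately obtain r where "r > 0" "\<forall>s>0. G r \<le> G s"
    using attains_inf_coercive by blast
  then show ?thesis using cost by (auto intro!: exI[of _ r] ennreal_leI)
next
  case False
  have "q_inf d p 0 s = top" if "s > 0" for s
    using q_inf_finite_everywhere[OF that zero_less_one, of d p 0] False by (auto simp: less_top[symmetric])
  then have "f_cost d p a m s = top" if "s > 0" for s
    using that unit_ball_vol_pos[of "real d", THEN less_imp_neq] \<open>d \<ge> 1\<close> by (simp add: f_cost_def ennreal_mult_top)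
  then show ?thesis by (auto intro: exI[of _ 1])
qed

text \<open>Attainment is what identifies the \<open>LEAST\<close> in \<open>f_min\<close> with an
  actual cost. The bound by \<open>kappa\<close> drops the other nonnegative terms at the minimizing
  radius and uses monotonicity of \<open>q_inf\<close> down to radius \<open>0\<close>.\<close>

lemma
  assumes "d \<ge> 1" "a > 0" "m > 0"
  shows f_min_le_f_cost: "r > 0 \<Longrightarrow> f_min d p a m \<le> f_cost d p a m r"
    and kappa_le_f_min: "kappa d p \<le> f_min d p a m"
proof -
  obtain r0 where r0: "r0 > 0" "\<And>s. s > 0 \<Longrightarrow> f_cost d p a m r0 \<le> f_cost d p a m s"
    using f_cost_attains_min[OF assms] by blast
  then have "(LEAST y. \<exists>r>0. y = f_cost d p a m r) = f_cost d p a m r0"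
    by (intro Least_equality) auto
  then have eq: "f_min d p a m = f_cost d p a m r0"
    using \<open>m > 0\<close> by (simp add: f_min_def)
  then show "r > 0 \<Longrightarrow> f_min d p a m \<le> f_cost d p a m r" using r0 by simp
  have "kappa d p \<le> ennreal (d * unit_ball_vol d) * q_inf d p 0 r0"
    unfolding kappa_def using r0 by (intro mult_left_mono q_inf_mono) auto
  also have "\<dots> \<le> f_cost d p a m r0" by (simp add: f_cost_def)
  finally show "kappa d p \<le> f_min d p a m" by (simp add: eq)
qed

section \<open>Convergence as the coefficient tends to zero\<close>

theorem lemmaA4:
  fixes d :: nat and p :: real and a :: "nat \<Rightarrow> real"
  assumes "d \<ge> 1" and "p > real d"
    and "\<And>i. a i > 0" and "decseq a" and "a \<longlonglongrightarrow> 0"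
  shows "\<forall>m\<ge>0. (\<lambda>i. f_min d p (a i) m) \<longlonglongrightarrow> kappa d p * indicator {0<..} m"
proof (intro allI impI)
  fix m :: real assume "m \<ge> 0"
  show "(\<lambda>i. f_min d p (a i) m) \<longlonglongrightarrow> kappa d p * indicator {0<..} m"
  proof (cases "m = 0")
    case True
    then show ?thesis by (simp add: f_min_def)
  next
    case False
    with \<open>m \<ge> 0\<close> have "m > 0" by simp
    define \<omega> where "\<omega> = unit_ball_vol (real d)"
    have "\<omega> > 0" by (simp add: \<omega>_def)
    have "(\<lambda>i. f_min d p (a i) m) \<longlonglongrightarrow> kappa d p"
    proof (rule order_tendstoI)
      fix y assume "y < kappa d p"
      then show "eventually (\<lambda>i. y < f_min d p (a i) m) sequentially"
        using kappa_le_f_min[OF assms(1) assms(3) \<open>m > 0\<close>] by (intro always_eventually allI) (rule less_le_trans)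
    next
      fix y assume y: "kappa d p < y"
      \<comment> \<open>The radius is chosen first, independently of \<open>i\<close>, by ignoring
        the term that contains \<open>a i\<close>.\<close>
      have "((\<lambda>r. ennreal (\<omega> * r ^ d) + ennreal (d * \<omega>) * q_inf d p 0 r)
          \<longlongrightarrow> ennreal (\<omega> * 0 ^ d) + ennreal (d * \<omega>) * q_inf d p 0 0) (at_right 0)"
        using assms(1,2)
        by (intro tendsto_add tendsto_ennrealI ennreal_tendsto_cmult tendsto_q_inf_at_right_0
            tendsto_mult tendsto_power tendsto_const tendsto_ident_at) auto
      also have "ennreal (\<omega> * 0 ^ d) + ennreal (d * \<omega>) * q_inf d p 0 0 = kappa d p"
        using \<open>d \<ge> 1\<close> by (simp add: kappa_def \<omega>_def)
      finally have "eventually (\<lambda>r. ennreal (\<omega> * r ^ d) + ennreal (d * \<omega>) * q_inf d p 0 r < y) (at_right 0)"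
        using y by (rule order_tendstoD)
      then have "eventually (\<lambda>r. ennreal (\<omega> * r ^ d) + ennreal (d * \<omega>) * q_inf d p 0 r < y \<and> r > 0) (at_right 0)"
        by (rule eventually_conj[OF _ eventually_at_right_less])
      then obtain r where r: "ennreal (\<omega> * r ^ d) + ennreal (d * \<omega>) * q_inf d p 0 r < y" "r > 0"
        using eventually_happens' trivial_limit_at_right_real by blast
      \<comment> \<open>With the radius fixed and positive, only the first term depends on
        \<open>i\<close>, and it vanishes in the limit.\<close>
      have "(\<lambda>i. ennreal (a i * m\<^sup>2 / (\<omega> * r ^ d) + \<omega> * r ^ d) + ennreal (d * \<omega>) * q_inf d p 0 r)
          \<longlonglongrightarrow> ennreal (0 * m\<^sup>2 / (\<omega> * r ^ d) + \<omega> * r ^ d) + ennreal (d * \<omega>) * q_inf d p 0 r"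
        using r(2) \<open>\<omega> > 0\<close>
        by (intro tendsto_add tendsto_ennrealI tendsto_divide tendsto_mult tendsto_const assms(5)) auto
      then have "eventually (\<lambda>i. f_cost d p (a i) m r < y) sequentially"
        unfolding f_cost_def \<omega>_def[symmetric] using r(1) by (intro order_tendstoD) auto
      then show "eventually (\<lambda>i. f_min d p (a i) m < y) sequentially"
        using f_min_le_f_cost[OF assms(1) assms(3) \<open>m > 0\<close> r(2)]
        by (rule eventually_mono[OF _ le_less_trans])
    qed
    then show ?thesis using \<open>m > 0\<close> by simp
  qed
qed

end
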